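(* Let $D\subset\mathbb{R}^\eta$ be a bounded polyhedron and let $f^k(x)=w^k\cdot x+b^k$, $k\in\{1,\dots,d\}$, be affine functions on $D$ that are irreducible (for every $k$ there is $x\in D$ with $f^k(x)>f^\ell(x)$ for all $\ell\ne k$). Let $R_{\mathrm{sharp}}$ be the set of all $(x,y,z)\in D\times\mathbb{R}\times\Delta^d$ satisfying $y\le\bar h(x,z)$ and $y\ge w^k\cdot x+b^k$ for all $k\in\{1,\dots,d\}$. Then $R_{\mathrm{sharp}}$ is equal to the set of all $(x,y,z)\in D\times\mathbb{R}\times\Delta^d$ such that $$y\le\alpha\cdot x+\sum_{k=1}^d\left(\max_{x^k\in D}\{(w^k-\alpha)\cdot x^k\}+b^k\right)z_k\qquad\forall\alpha\in\mathbb{R}^\eta,$$ $$y\ge w^k\cdot x+b^k\qquad\forall k\in\{1,\dots,d\}.$$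
   Context: $\Delta^d=\{z\in\mathbb{R}^d_{\ge0}:\sum_k z_k=1\}$. For $t\ge 0$ and $A\subseteq\mathbb{R}^\eta$, $t\cdot A=\{ta: a\in A\}$. For $(x,z)\in D\times\Delta^d$, $\bar h(x,z)=\max\{\sum_{k=1}^d(w^k\cdot\tilde x^k+b^kz_k): x=\sum_{k=1}^d\tilde x^k,\ \tilde x^k\in z_k\cdot D\ \forall k\}$, the maximum being over $\tilde x^1,\dots,\tilde x^d\in\mathbb{R}^\eta$. *)

theory Defs
  imports "HOL-Analysis.Analysis"
begin

definition std_simplex :: "(real ^ 'd::finite) set" where
  "std_simplex = {z. (\<forall>k. 0 \<le> z $ k) \<and> (\<Sum>k\<in>UNIV. z $ k) = 1}"

text \<open>The maximum of \<open>f\<close> over a possibly infinite set: the greatest element of the image,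
  hence meaningful only when the maximum is attained. This is the case below whenever
  \<open>D\<close> is nonempty and compact, \<open>x \<in> D\<close> and \<open>z\<close> lies in the simplex.\<close>

definition max_over :: "'a set \<Rightarrow> ('a \<Rightarrow> real) \<Rightarrow> real" where
  "max_over S f = (GREATEST v. v \<in> f ` S)"

definition irreducible_family :: "'a set \<Rightarrow> ('d \<Rightarrow> 'a \<Rightarrow> real) \<Rightarrow> bool" where
  "irreducible_family D f \<longleftrightarrow> (\<forall>k. \<exists>x\<in>D. \<forall>l. l \<noteq> k \<longrightarrow> f k x > f l x)"

definition decompositions ::
  "(real ^ 'n) set \<Rightarrow> real ^ 'n \<Rightarrow> real ^ 'd \<Rightarrow> ('d::finite \<Rightarrow> real ^ 'n) set" where
  "decompositions D x z =
    {xt. x = (\<Sum>k\<in>UNIV. xt k) \<and> (\<forall>k. xt k \<in> (\<lambda>a. (z $ k) *\<^sub>R a) ` D)}"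

definition hbar ::
  "(real ^ 'n::finite) set \<Rightarrow> ('d::finite \<Rightarrow> real ^ 'n) \<Rightarrow> ('d \<Rightarrow> real) \<Rightarrow>
    real ^ 'n \<Rightarrow> real ^ 'd \<Rightarrow> real" where
  "hbar D w b x z =
    max_over (decompositions D x z) (\<lambda>xt. \<Sum>k\<in>UNIV. w k \<bullet> xt k + b k * z $ k)"

definition R_sharp ::
  "(real ^ 'n::finite) set \<Rightarrow> ('d::finite \<Rightarrow> real ^ 'n) \<Rightarrow> ('d \<Rightarrow> real) \<Rightarrow>
    ((real ^ 'n) \<times> real \<times> (real ^ 'd)) set" where
  "R_sharp D w b =
    {(x, y, z). x \<in> D \<and> z \<in> std_simplex \<and> y \<le> hbar D w b x z \<and> (\<forall>k. y \<ge> w k \<bullet> x + b k)}"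

end

(* The value hbar(x, z) is the maximum of a linear functional over the ways of writing x as
   sum_k z_k a_k with all a_k in D. Splitting off alpha . x shows that it lies below every
   alpha-bound. Conversely, the pairs (sum_k z_k a_k, sum_k z_k f^k(a_k)) with all a_k in D form a
   compact convex set, and if y > hbar(x, z) then this set misses the vertical ray above (x, y).
   A strictly separating hyperplane is not vertical, because the set meets the line over x, and its
   slope is an alpha whose bound y violates. *)

theory Submission
  imports Defs
begin

lemma max_over_eq:
  assumes "s \<in> S" "\<And>t. t \<in> S \<Longrightarrow> f t \<le> f s"
  shows "max_over S f = f s"
  unfolding max_over_def using assms by (intro Greatest_equality) auto

text \<open>\<open>GREATEST\<close> carries information only if a greatest element exists.
  Compactness and continuity supply one, so every later use of \<open>max_over\<close> goes through
  an actual maximiser.\<close>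

lemma max_over_attained:
  fixes f :: "'a::topological_space \<Rightarrow> real"
  assumes "compact S" "S \<noteq> {}" "continuous_on S f"
  obtains s where "s \<in> S" "max_over S f = f s" "\<And>t. t \<in> S \<Longrightarrow> f t \<le> max_over S f"
proof -
  obtain s where s: "s \<in> S" "\<forall>t\<in>S. f t \<le> f s"
    using continuous_attains_sup[OF assms] by blast
  then show thesis
    using that[of s] max_over_eq[of s S f] by auto
qed

text \<open>Choices of one point of \<open>D\<close> per index are encoded as vectors, so that
  closedness and boundedness give compactness. Boundedness follows by estimating the L2 distance by
  the sum of the coordinate distances.\<close>

lemma compact_vec_box:
  fixes D :: "'a::heine_borel set"
  assumes "compact D"
  shows "compact {A :: 'a ^ 'd::finite. \<forall>k. A $ k \<in> D}"
proof -
  have "closed {A :: 'a ^ 'd. \<forall>k. A $ k \<in> D}"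
    using closed_vector_box[of "\<lambda>_. D"] compact_imp_closed[OF assms] by auto
  moreover have "bounded {A :: 'a ^ 'd. \<forall>k. A $ k \<in> D}"
  proof -
    obtain c e where e: "\<And>a. a \<in> D \<Longrightarrow> dist c a \<le> e"
      using compact_imp_bounded[OF assms] unfolding bounded_def by blast
    have "dist (\<chi> _. c) A \<le> real CARD('d) * e" if "\<forall>k. A $ k \<in> D" for A :: "'a ^ 'd"
    proof -
      have "dist (\<chi> _. c) A \<le> (\<Sum>k\<in>UNIV. dist c (A $ k))"
        unfolding dist_vec_def by (rule order_trans[OF L2_set_le_sum]) auto
      also have "\<dots> \<le> (\<Sum>k\<in>(UNIV :: 'd set). e)"
        using that e by (intro sum_mono) auto
      finally show ?thesis by simp
    qed
    then show ?thesis unfolding bounded_def by blast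
  qed
  ultimately show ?thesis by (simp add: compact_eq_bounded_closed)
qed

lemma convex_vec_box:
  fixes D :: "'a::real_vector set"
  assumes "convex D"
  shows "convex {A :: 'a ^ 'd::finite. \<forall>k. A $ k \<in> D}"
  using assms by (auto simp: convex_def)

text \<open>Choosing a point of \<open>D\<close> behind each scaled summand moves the maximisation
  to tuples in the compact box. The choice is not unique when \<open>z $ k = 0\<close>, so this is
  an image and not a bijection.\<close>

lemma decompositions_eq:
  "decompositions D x z =
    (\<lambda>A k. z $ k *\<^sub>R A $ k) ` {A. (\<forall>k. A $ k \<in> D) \<and> (\<Sum>k\<in>UNIV. z $ k *\<^sub>R A $ k) = x}"
proof (intro equalityI subsetI)
  fix xt assume xt: "xt \<in> decompositions D x z"
  then have "\<forall>k. \<exists>a. a \<in> D \<and> xt k = z $ k *\<^sub>R a"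
    by (auto simp: decompositions_def)
  then obtain a where a: "\<And>k. a k \<in> D" "\<And>k. xt k = z $ k *\<^sub>R a k"
    by metis
  have "xt = (\<lambda>k. z $ k *\<^sub>R (\<chi> k. a k) $ k)"
    using a by auto
  moreover have "(\<Sum>k\<in>UNIV. z $ k *\<^sub>R (\<chi> k. a k) $ k) = x"
    using xt a by (simp add: decompositions_def)
  ultimately show "xt \<in> (\<lambda>A k. z $ k *\<^sub>R A $ k) `
      {A. (\<forall>k. A $ k \<in> D) \<and> (\<Sum>k\<in>UNIV. z $ k *\<^sub>R A $ k) = x}"
    using a(1) by (intro image_eqI[of _ _ "\<chi> k. a k"]) auto
qed (auto simp: decompositions_def)

lemma hbar_attained:
  fixes D :: "(real ^ 'n::finite) set" and w :: "'d::finite \<Rightarrow> real ^ 'n"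
  assumes "compact D" "x \<in> D" "z \<in> std_simplex"
  obtains A :: "(real ^ 'n) ^ 'd" where
    "\<And>k. A $ k \<in> D" "(\<Sum>k\<in>UNIV. z $ k *\<^sub>R A $ k) = x"
    "hbar D w b x z = (\<Sum>k\<in>UNIV. z $ k * (w k \<bullet> A $ k + b k))"
    "\<And>B :: (real ^ 'n) ^ 'd. (\<And>k. B $ k \<in> D) \<Longrightarrow> (\<Sum>k\<in>UNIV. z $ k *\<^sub>R B $ k) = x \<Longrightarrow>
      (\<Sum>k\<in>UNIV. z $ k * (w k \<bullet> B $ k + b k)) \<le> hbar D w b x z"
proof -
  define S :: "((real ^ 'n) ^ 'd) set"
    where "S = {A. (\<forall>k. A $ k \<in> D) \<and> (\<Sum>k\<in>UNIV. z $ k *\<^sub>R A $ k) = x}"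
  define f where "f A = (\<Sum>k\<in>UNIV. z $ k * (w k \<bullet> A $ k + b k))" for A :: "(real ^ 'n) ^ 'd"
  have "S = {A. \<forall>k. A $ k \<in> D} \<inter> {A. (\<Sum>k\<in>UNIV. z $ k *\<^sub>R A $ k) = x}"
    unfolding S_def by auto
  moreover have "closed {A :: (real ^ 'n) ^ 'd. (\<Sum>k\<in>UNIV. z $ k *\<^sub>R A $ k) = x}"
    by (intro closed_Collect_eq continuous_intros)
  ultimately have "compact S"
    using compact_vec_box[OF assms(1)] by (auto intro: compact_Int_closed)
  \<comment> \<open>The constant tuple is feasible because the weights \<open>z $ k\<close> sum to
    1.\<close>
  moreover have "(\<chi> k. x) \<in> S"
    using assms(2,3) by (simp add: S_def std_simplex_def flip: scaleR_sum_left)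
  moreover have "continuous_on S f"
    unfolding f_def by (intro continuous_intros)
  ultimately obtain A where A: "A \<in> S" "max_over S f = f A" "\<And>B. B \<in> S \<Longrightarrow> f B \<le> max_over S f"
    using max_over_attained[of S f] by blast
  \<comment> \<open>Both sides are the greatest element of the same set of reals: the objective on
    decompositions, composed with the scaling map, is \<open>f\<close>.\<close>
  have "hbar D w b x z = max_over S f"
    unfolding hbar_def decompositions_eq max_over_def S_def f_def image_image
    by (simp add: algebra_simps)
  then show thesis
    using that[of A] A by (auto simp: S_def f_def)
qed

text \<open>Weak duality: for a maximising tuple \<open>A\<close>, splitting \<alpha> \<bullet> x
  along \<open>A\<close> leaves the terms (w k - \<alpha>) \<bullet> A $ k. Each is at most its
  maximum over \<open>D\<close>, and the weights are nonnegative.\<close>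

lemma hbar_le_dual_bound:
  fixes D :: "(real ^ 'n::finite) set" and w :: "'d::finite \<Rightarrow> real ^ 'n"
  assumes "compact D" "x \<in> D" "z \<in> std_simplex"
  shows "hbar D w b x z \<le>
    \<alpha> \<bullet> x + (\<Sum>k\<in>UNIV. (max_over D (\<lambda>a. (w k - \<alpha>) \<bullet> a) + b k) * z $ k)"
proof -
  obtain A :: "(real ^ 'n) ^ 'd" where A: "\<And>k. A $ k \<in> D" "(\<Sum>k\<in>UNIV. z $ k *\<^sub>R A $ k) = x"
    "hbar D w b x z = (\<Sum>k\<in>UNIV. z $ k * (w k \<bullet> A $ k + b k))"
    using hbar_attained[OF assms] by blast
  have "(w k - \<alpha>) \<bullet> A $ k \<le> max_over D (\<lambda>a. (w k - \<alpha>) \<bullet> a)" for k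
    by (rule max_over_attained[of D "\<lambda>a. (w k - \<alpha>) \<bullet> a"])
      (use assms A(1) in \<open>auto intro!: continuous_intros\<close>)
  then have "(\<Sum>k\<in>UNIV. ((w k - \<alpha>) \<bullet> A $ k + b k) * z $ k) \<le>
      (\<Sum>k\<in>UNIV. (max_over D (\<lambda>a. (w k - \<alpha>) \<bullet> a) + b k) * z $ k)"
    using assms(3) by (intro sum_mono mult_right_mono add_mono) (auto simp: std_simplex_def)
  moreover have "\<alpha> \<bullet> x = (\<Sum>k\<in>UNIV. z $ k * (\<alpha> \<bullet> A $ k))"
    unfolding A(2)[symmetric] by (simp add: inner_sum_right)
  then have "hbar D w b x z = \<alpha> \<bullet> x + (\<Sum>k\<in>UNIV. ((w k - \<alpha>) \<bullet> A $ k + b k) * z $ k)"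
    unfolding A(3) by (simp add: algebra_simps flip: sum.distrib)
  ultimately show ?thesis by simp
qed

lemma dual_bound_less:
  fixes D :: "(real ^ 'n::finite) set" and w :: "'d::finite \<Rightarrow> real ^ 'n"
  assumes "compact D" "convex D" "x \<in> D" "z \<in> std_simplex" "hbar D w b x z < y"
  obtains \<alpha> where
    "\<alpha> \<bullet> x + (\<Sum>k\<in>UNIV. (max_over D (\<lambda>a. (w k - \<alpha>) \<bullet> a) + b k) * z $ k) < y"
proof -
  define P where "P = {A :: (real ^ 'n) ^ 'd. \<forall>k. A $ k \<in> D}"
  define L where "L A = (\<Sum>k\<in>UNIV. z $ k *\<^sub>R A $ k, \<Sum>k\<in>UNIV. z $ k * (w k \<bullet> A $ k))"
    for A :: "(real ^ 'n) ^ 'd"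
  \<comment> \<open>The constants \<open>b k\<close> are kept apart so that \<open>L\<close> is
    linear; \<open>S\<close> is then a translate of a linear image of a convex box.\<close>
  define c where "c = (0 :: real ^ 'n, \<Sum>k\<in>UNIV. z $ k * b k)"
  define S where "S = (\<lambda>A. c + L A) ` P"
  define T where "T = {x} \<times> {y..}"
  have value_eq: "c + L A = (\<Sum>k\<in>UNIV. z $ k *\<^sub>R A $ k, \<Sum>k\<in>UNIV. z $ k * (w k \<bullet> A $ k + b k))"
    for A
    by (simp add: c_def L_def algebra_simps flip: sum.distrib)
  obtain A where A: "A \<in> P" "c + L A = (x, hbar D w b x z)"
    and maximal: "\<And>B. B \<in> P \<Longrightarrow> fst (c + L B) = x \<Longrightarrow> snd (c + L B) \<le> hbar D w b x z"
    by (rule hbar_attained[OF assms(1,3,4), of w b]) (auto simp: P_def value_eq)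
  have "linear L"
    unfolding L_def
    by (intro linearI) (simp_all add: algebra_simps sum.distrib scaleR_sum_right sum_distrib_left)
  then have "convex (L ` P)"
    unfolding P_def by (intro convex_linear_image convex_vec_box assms)
  then have "convex S"
    unfolding S_def image_image[of "\<lambda>v. c + v" L P, symmetric] by (rule convex_translation)
  moreover have "compact S"
    unfolding S_def P_def L_def
    by (intro compact_continuous_image continuous_intros compact_vec_box assms)
  moreover have "S \<noteq> {}"
    using A(1) by (auto simp: S_def)
  moreover have "convex T" "closed T"
    unfolding T_def by (auto intro: convex_Times closed_Times)
  moreover have "S \<inter> T = {}"
  proof -
    have "c + L B \<notin> T" if "B \<in> P" for B
      using maximal[OF that] assms(5) by (cases "c + L B") (auto simp: T_def)
    then show ?thesis by (auto simp: S_def)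
  qed
  ultimately obtain p q r where sep: "\<And>s. s \<in> S \<Longrightarrow> (p, q) \<bullet> s < r" "\<And>t. t \<in> T \<Longrightarrow> (p, q) \<bullet> t > r"
    using separating_hyperplane_compact_closed[of S T] by (metis surj_pair)
  have below: "p \<bullet> u + q * v < r" if "(u, v) \<in> S" for u v
    using sep(1)[OF that] by simp
  have above: "p \<bullet> x + q * y > r"
    using sep(2)[of "(x, y)"] by (simp add: T_def)
  \<comment> \<open>The point of \<open>S\<close> given by \<open>A\<close> lies strictly below (x,
    y) on the same vertical line, so separating the two forces \<open>q > 0\<close>.\<close>
  have "p \<bullet> x + q * hbar D w b x z < r"
    using below A unfolding S_def by (metis image_eqI)
  with above have "q * (y - hbar D w b x z) > 0"
    by (simp add: algebra_simps)
  then have q: "q > 0"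
    using assms(5) by (simp add: zero_less_mult_iff)
  \<comment> \<open>Solving p \<bullet> u + q * v = r for \<open>v\<close> gives v = \<alpha>
    \<bullet> u + r / q, so \<alpha> is the slope of the hyperplane.\<close>
  define \<alpha> where "\<alpha> = - (p /\<^sub>R q)"
  have p: "p = - (q *\<^sub>R \<alpha>)"
    using q by (simp add: \<alpha>_def)
  have "\<exists>a\<in>D. max_over D (\<lambda>a. (w k - \<alpha>) \<bullet> a) = (w k - \<alpha>) \<bullet> a" for k
    by (rule max_over_attained[of D "\<lambda>a. (w k - \<alpha>) \<bullet> a"])
      (use assms in \<open>auto intro!: continuous_intros\<close>)
  then obtain a where a: "\<And>k. a k \<in> D"
    "\<And>k. max_over D (\<lambda>a. (w k - \<alpha>) \<bullet> a) = (w k - \<alpha>) \<bullet> a k"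
    by metis
  \<comment> \<open>Taking a maximiser in every coordinate gives a point (u, v) of \<open>S\<close>
    where v - \<alpha> \<bullet> u is largest. Separation at this point, divided by
    \<open>q\<close>, is the violated bound.\<close>
  define u v where "u = (\<Sum>k\<in>UNIV. z $ k *\<^sub>R a k)"
    and "v = (\<Sum>k\<in>UNIV. z $ k * (w k \<bullet> a k + b k))"
  have "(\<chi> k. a k) \<in> P" "c + L (\<chi> k. a k) = (u, v)"
    using a(1) unfolding value_eq by (simp_all add: P_def u_def v_def)
  then have "(u, v) \<in> S"
    unfolding S_def by (metis image_eqI)
  then have "p \<bullet> u + q * v < p \<bullet> x + q * y"
    using below above by fastforce
  then have "q * (\<alpha> \<bullet> x + (v - \<alpha> \<bullet> u)) < q * y"
    by (simp add: p algebra_simps)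
  then have "\<alpha> \<bullet> x + (v - \<alpha> \<bullet> u) < y"
    using q by simp
  moreover have "v - \<alpha> \<bullet> u = (\<Sum>k\<in>UNIV. ((w k - \<alpha>) \<bullet> a k + b k) * z $ k)"
    unfolding u_def v_def by (simp add: inner_sum_right algebra_simps flip: sum_subtractf)
  ultimately show thesis
    using that[of \<alpha>] by (simp add: a(2))
qed

theorem proposition6:
  fixes D :: "(real ^ 'n::finite) set"
    and w :: "'d::finite \<Rightarrow> real ^ 'n"
    and b :: "'d \<Rightarrow> real"
  assumes "polyhedron D"
    and "bounded D"
    and "irreducible_family D (\<lambda>k x. w k \<bullet> x + b k)"
  shows "R_sharp D w b =
    {(x, y, z). x \<in> D \<and> z \<in> std_simplex \<and>
      (\<forall>\<alpha>. y \<le> \<alpha> \<bullet> x +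
        (\<Sum>k\<in>UNIV. (max_over D (\<lambda>xk. (w k - \<alpha>) \<bullet> xk) + b k) * z $ k)) \<and>
      (\<forall>k. y \<ge> w k \<bullet> x + b k)}"
proof -
  have D: "compact D" "convex D"
    using assms(1,2)
    by (auto simp: compact_eq_bounded_closed polyhedron_imp_closed polyhedron_imp_convex)
  \<comment> \<open>The two sets differ only in the upper bound on \<open>y\<close>. One direction
    is weak duality; the other is the contrapositive of \<open>dual_bound_less\<close>.\<close>
  have "y \<le> hbar D w b x z \<longleftrightarrow>
      (\<forall>\<alpha>. y \<le> \<alpha> \<bullet> x +
        (\<Sum>k\<in>UNIV. (max_over D (\<lambda>xk. (w k - \<alpha>) \<bullet> xk) + b k) * z $ k))"
    if "x \<in> D" "z \<in> std_simplex" for x y z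
    using hbar_le_dual_bound[OF D(1) that] dual_bound_less[OF D that]
    by (meson leD leI order_trans)
  then show ?thesis
    unfolding R_sharp_def by auto
qed

end
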